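(* For an integer $n\geq 2$, the following conditions are equivalent. (i) The involutory Cayley graph $\mathcal{G}(\mathbb{Z}_n[x])$ of $\mathbb{Z}_n[x]$ is planar. (ii) The involutory Cayley graph $\mathcal{G}(\mathbb{Z}_n)$ of $\mathbb{Z}_n$ is planar and $n\neq 4$. (iii) $n=2$, or $n=p^k$ or $n=2p^k$ for some odd prime number $p$ and positive integer $k$.
   Context: $\mathbb{Z}_n$ denotes the ring of integers modulo $n$. For a commutative ring $R$ with identity, the involutory Cayley graph $\mathcal{G}(R)$ is the simple undirected graph with vertex set $R$ in which two vertices $a,b$ are adjacent if and only if $(a-b)^2=1$. A (possibly infinite) graph is planar if it can be embedded in the plane such that no two edges intersect except at their endpoints. *)

theory Defs
  imports "HOL-Analysis.Analysis" "HOL-Number_Theory.Residues" "HOL-Algebra.UnivPoly"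
begin

type_synonym 'v ugraph = "'v set \<times> 'v set set"

(* "Two vertices" means two distinct vertices, so that the graph is simple also over the
   zero ring; over a nontrivial ring a \<noteq> b already follows from (a - b)^2 = 1.
   Adjacency is symmetric because (b - a)^2 = (a - b)^2. *)
definition involutory_cayley_graph :: "('a, 'm) ring_scheme \<Rightarrow> 'a ugraph" where
  "involutory_cayley_graph R =
     (carrier R,
      {{a, b} | a b. a \<in> carrier R \<and> b \<in> carrier R \<and> a \<noteq> b \<and>
                     (a \<ominus>\<^bsub>R\<^esub> b) [^]\<^bsub>R\<^esub> (2::nat) = \<one>\<^bsub>R\<^esub>})"

(* A drawing of a possibly infinite simple graph in the plane, identified with the complex
   numbers: vertices are distinct points, each edge is an arc joining its two ends and
   containing no other vertex, and distinct edges meet at most in common ends. No condition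
   is placed on accumulation of vertices or edges. *)
definition plane_drawing ::
    "'v ugraph \<Rightarrow> ('v \<Rightarrow> complex) \<Rightarrow> ('v set \<Rightarrow> real \<Rightarrow> complex) \<Rightarrow> bool" where
  "plane_drawing G p \<gamma> \<longleftrightarrow>
     inj_on p (fst G) \<and>
     (\<forall>e\<in>snd G. arc (\<gamma> e) \<and>
        {pathstart (\<gamma> e), pathfinish (\<gamma> e)} = p ` e \<and>
        path_image (\<gamma> e) \<inter> p ` fst G = p ` e) \<and>
     (\<forall>e\<in>snd G. \<forall>e'\<in>snd G. e \<noteq> e' \<longrightarrow>
        path_image (\<gamma> e) \<inter> path_image (\<gamma> e') \<subseteq> p ` e \<inter> p ` e')"

definition planar :: "'v ugraph \<Rightarrow> bool" where
  "planar G \<longleftrightarrow> (\<exists>p \<gamma>. plane_drawing G p \<gamma>)"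

end

theory Submission
  imports Defs
begin

text \<open>
  Everything is governed by the square roots of 1.  If $n = 2$, $n = p^k$ or $n = 2p^k$ with $p$ an
  odd prime, then $\pm 1$ are the only square roots of 1, not only in $\mathbb{Z}_n$ but even in
  $\mathbb{Z}_n[x]$: comparing coefficients shows that a square root of 1 has no terms of positive
  degree unless 4 divides $n$ (\<open>higher_coefficients_vanish\<close>).  The graph of $\mathbb{Z}_n[x]$ is then a
  countable union of disjoint cycles of length $n$, or of disjoint edges when $n = 2$, and can be
  drawn on concentric circles (\<open>disjoint_cycles_planar\<close>).  The graph of $\mathbb{Z}_n$ embeds in that of
  $\mathbb{Z}_n[x]$ through the constant polynomials, so it inherits planarity.

  For every other $n \<noteq> 4$ there is a square root $u$ of 1 in $\mathbb{Z}_n$ different from $\pm 1$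
  (\<open>nontrivial_involution\<close>).  The graph of $\mathbb{Z}_n$ contains the Hamiltonian cycle
  $0, 1, \<dots>, n - 1$ and all the chords from $i$ to $i + u$, and the three chords starting at 0, 1 and
  2 cross pairwise.  For $n = 4$ the graph of $\mathbb{Z}_4$ is a 4-cycle, but $\mathbb{Z}_4[x]$ has
  infinitely many square roots $1 + 2f$ of 1, and a hexagon with its three long diagonals appears.

  The topological core is thus that a cycle with three pairwise crossing chords, a subdivision of
  $K_{3,3}$, has no plane drawing by arcs (\<open>cycle_with_three_crossing_chords_not_planar\<close>).  It is
  reduced to a statement on theta curves (\<open>theta_curve_misses_an_arc\<close>), which follows from the
  Jordan curve theorem and Janiszewski's theorem.
\<close>

section \<open>Theta curves in the plane\<close>

lemma connected_component_separated:
  assumes "open X" "open Y" "X \<inter> Y = {}" "x \<in> X" "connected_component (X \<union> Y) x y"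
  shows "y \<in> X"
proof (rule ccontr)
  assume "y \<notin> X"
  obtain T where T: "connected T" "T \<subseteq> X \<union> Y" "x \<in> T" "y \<in> T"
    using assms(5) by (auto simp: connected_component_def)
  with \<open>y \<notin> X\<close> assms(4) have "X \<inter> T \<noteq> {}" "Y \<inter> T \<noteq> {}"
    by auto
  with connectedD[OF T(1) assms(1,2)] T(2) assms(3) show False
    by auto
qed

text \<open>
  The three arcs of a theta curve cut the plane into three regions, each of which touches only two
  of the arcs.  Hence no point can be joined to a point of each arc while avoiding the other two;
  applied to a third branch vertex, this is the non-planarity of $K_{3,3}$.
  
  The contradiction needs neither inside nor outside.  By the Jordan curve theorem the simple closed
  curve formed by the first two arcs has exactly two complementary regions, and \<open>x\<close> and the third
  arc lie in the same one.  Take \<open>y\<close> in the other region \<open>Y\<close>.  As the whole curve is the frontier of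
  \<open>Y\<close>, the point \<open>y\<close> reaches the first arc without meeting the other two, and from there it reaches
  \<open>x\<close>; the same works with the second arc.  The two obstacles avoided in this way intersect in the
  third arc, which is connected, so Janiszewski's theorem joins \<open>y\<close> to \<open>x\<close> outside their union,
  that is, across the closed curve.
\<close>

lemma theta_curve_misses_an_arc:
  fixes g1 g2 g3 :: "real \<Rightarrow> complex"
  assumes arcs: "arc g1" "arc g2" "arc g3"
    and starts: "pathstart g1 = a" "pathstart g2 = a" "pathstart g3 = a"
    and finishes: "pathfinish g1 = b" "pathfinish g2 = b" "pathfinish g3 = b"
    and meet: "path_image g1 \<inter> path_image g2 \<subseteq> {a, b}"
      "path_image g1 \<inter> path_image g3 \<subseteq> {a, b}"
      "path_image g2 \<inter> path_image g3 \<subseteq> {a, b}"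
    and q: "q1 \<in> path_image g1" "q2 \<in> path_image g2" "q3 \<in> path_image g3"
    and x1: "connected_component (- (path_image g2 \<union> path_image g3)) x q1"
    and x2: "connected_component (- (path_image g1 \<union> path_image g3)) x q2"
    and x3: "connected_component (- (path_image g1 \<union> path_image g2)) x q3"
  shows False
proof -
  let ?C = "path_image g1 \<union> path_image g2"
  have ab: "a \<in> path_image g1" "a \<in> path_image g2" "a \<in> path_image g3"
    "b \<in> path_image g1" "b \<in> path_image g2" "b \<in> path_image g3"
    using starts finishes pathstart_in_path_image pathfinish_in_path_image by metis+
  have "simple_path (g1 +++ reversepath g2)"
    by (rule simple_path_join_loop) (use arcs starts finishes meet arc_reversepath in auto)
  moreover have C: "path_image (g1 +++ reversepath g2) = ?C"
    by (subst path_image_join) (use starts finishes in auto)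
  moreover have "pathfinish (g1 +++ reversepath g2) = pathstart (g1 +++ reversepath g2)"
    using starts finishes by simp
  ultimately obtain I O' where IO: "I \<noteq> {}" "open I" "connected I"
      "O' \<noteq> {}" "open O'" "connected O'" "I \<inter> O' = {}" "I \<union> O' = - ?C"
      "frontier I = ?C" "frontier O' = ?C"
    using Jordan_curve[of "g1 +++ reversepath g2"] by metis
  have "x \<in> - ?C"
    using connected_component_in[OF x3] by simp
  then obtain X Y where X: "open X" "x \<in> X" and Y: "open Y" "connected Y" "Y \<noteq> {}"
      "frontier Y = ?C" and XY: "X \<inter> Y = {}" "X \<union> Y = - ?C"
    using IO by (metis Int_commute Un_commute Un_iff)
  obtain y where "y \<in> Y"
    using Y by blast
  have same_side: "z \<in> X" if "connected_component (- ?C) x z" for z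
    using connected_component_separated[OF X(1) Y(1) XY(1) X(2)] that XY(2) by simp
  have "path_image g3 - {a, b} \<subseteq> X"
  proof
    fix z assume z: "z \<in> path_image g3 - {a, b}"
    have "q3 \<in> path_image g3 - {a, b}"
      using q(3) connected_component_in[OF x3] ab by auto
    moreover have "connected (path_image g3 - {a, b})"
      using connected_simple_path_endless[OF arc_imp_simple_path[OF arcs(3)]]
        starts(3) finishes(3) by simp
    moreover have "path_image g3 - {a, b} \<subseteq> - ?C"
      using meet by auto
    ultimately have "connected_component (- ?C) q3 z"
      using z by (auto simp: connected_component_def)
    with x3 show "z \<in> X"
      using same_side connected_component_trans by metis
  qed
  with XY ab have Yg: "Y \<inter> path_image g3 = {}"
    by auto
  \<comment> \<open>Growing \<open>Y\<close> by a small disc around a point \<open>q\<close> of its frontier gives a connected set that contains \<open>q\<close>.\<close>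
  have reach: "connected_component (- D) y x"
    if q: "q \<in> ?C" and D: "closed D" "D \<subseteq> ?C \<union> path_image g3"
      and c: "connected_component (- D) x q" for q D
  proof -
    have "q \<in> - D"
      using connected_component_in[OF c] by simp
    then obtain e where e: "e > 0" "ball q e \<subseteq> - D"
      using D(1) open_contains_ball[of "- D"] by (auto simp: open_Compl)
    have "q \<in> closure Y"
      using q Y(4) by (auto simp: frontier_def)
    then have "ball q e \<inter> Y \<noteq> {}"
      using e(1) by (metis centre_in_ball disjoint_iff open_Int_closure_eq_empty open_ball)
    then have "connected (Y \<union> ball q e)"
      using Y(2) by (intro connected_Un) auto
    moreover have "Y \<union> ball q e \<subseteq> - D"
      using e D(2) XY(2) Yg by auto
    ultimately have "connected_component (- D) y q"
      using \<open>y \<in> Y\<close> e(1) unfolding connected_component_def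
      by (intro exI[of _ "Y \<union> ball q e"]) auto
    with c show ?thesis
      using connected_component_sym connected_component_trans by metis
  qed
  have cl: "compact (path_image g1)" "compact (path_image g2)" "compact (path_image g3)"
    using arcs by (auto intro: compact_arc_image)
  have "connected_component (- (path_image g2 \<union> path_image g3)) y x"
    using q x1 cl by (intro reach[of q1]) (auto intro!: compact_imp_closed)
  moreover have "connected_component (- (path_image g1 \<union> path_image g3)) y x"
    using q x2 cl by (intro reach[of q2]) (auto intro!: compact_imp_closed)
  moreover have "(path_image g2 \<union> path_image g3) \<inter> (path_image g1 \<union> path_image g3) = path_image g3"
    using meet ab by auto
  moreover have "closed (path_image g1 \<union> path_image g3)" "compact (path_image g2 \<union> path_image g3)"
    using cl by (auto intro: closed_Un compact_Un compact_imp_closed)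
  ultimately have "connected_component
      (- ((path_image g2 \<union> path_image g3) \<union> (path_image g1 \<union> path_image g3))) y x"
    using connected_arc_image[OF arcs(3)] by (metis Janiszewski)
  then have "connected_component (- ?C) y x"
    by (rule connected_component_of_subset) auto
  then have "y \<in> X"
    using same_side connected_component_sym by metis
  with \<open>y \<in> Y\<close> XY(1) show False
    by auto
qed

section \<open>Drawn paths and crossing chords\<close>

definition graph_path :: "'v ugraph \<Rightarrow> 'v list \<Rightarrow> bool" where
  "graph_path G xs \<longleftrightarrow> length xs \<ge> 2 \<and> distinct xs \<and> set xs \<subseteq> fst G \<and>
     successively (\<lambda>x y. {x, y} \<in> snd G) xs"

fun drawn_path :: "('v set \<Rightarrow> real \<Rightarrow> complex) \<Rightarrow> 'v list \<Rightarrow> complex set" where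
  "drawn_path \<gamma> (x # y # xs) = path_image (\<gamma> {x, y}) \<union> drawn_path \<gamma> (y # xs)"
| "drawn_path \<gamma> _ = {}"

lemma drawn_path_edgeE:
  assumes "z \<in> drawn_path \<gamma> xs" "successively P xs"
  obtains x y where "z \<in> path_image (\<gamma> {x, y})" "{x, y} \<subseteq> set xs" "P x y"
  using assms by (induction \<gamma> xs rule: drawn_path.induct) auto

lemma edges_meet_in_common_vertices:
  assumes draw: "plane_drawing G p \<gamma>" and "e \<in> snd G" "f \<in> snd G" "e \<noteq> f"
    and V: "e \<subseteq> fst G" "f \<subseteq> fst G"
  shows "path_image (\<gamma> e) \<inter> path_image (\<gamma> f) \<subseteq> p ` (e \<inter> f)"
proof -
  have "path_image (\<gamma> e) \<inter> path_image (\<gamma> f) \<subseteq> p ` e \<inter> p ` f"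
    using assms unfolding plane_drawing_def by blast
  also have "\<dots> = p ` (e \<inter> f)"
    using draw V unfolding plane_drawing_def
    by (intro inj_on_image_Int[symmetric, of p "fst G"]) auto
  finally show ?thesis .
qed

text \<open>
  Two drawn edges meet only in common ends, so two drawn paths without a common edge meet only in
  common vertices.  It suffices to ask that no edge of \<open>xs\<close> has both its ends on \<open>ys\<close>, which is read
  off from the vertices alone.
\<close>

lemma drawn_paths_meet_in_common_vertices:
  assumes draw: "plane_drawing G p \<gamma>" and xs: "graph_path G xs" and ys: "graph_path G ys"
    and no_common_edge: "successively (\<lambda>x y. \<not> {x, y} \<subseteq> set ys) xs"
  shows "drawn_path \<gamma> xs \<inter> drawn_path \<gamma> ys \<subseteq> p ` (set xs \<inter> set ys)"
proof
  fix z assume z: "z \<in> drawn_path \<gamma> xs \<inter> drawn_path \<gamma> ys"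
  have "successively (\<lambda>x y. {x, y} \<in> snd G \<and> \<not> {x, y} \<subseteq> set ys) xs"
    using xs no_common_edge by (simp add: graph_path_def successively_conv_nth)
  with z obtain a b where e: "z \<in> path_image (\<gamma> {a, b})" "{a, b} \<subseteq> set xs"
      "{a, b} \<in> snd G" "\<not> {a, b} \<subseteq> set ys"
    by (auto elim!: drawn_path_edgeE)
  obtain c d where f: "z \<in> path_image (\<gamma> {c, d})" "{c, d} \<subseteq> set ys" "{c, d} \<in> snd G"
    using z ys by (auto simp: graph_path_def elim!: drawn_path_edgeE)
  have "{a, b} \<noteq> {c, d}"
    using e(4) f(2) by metis
  moreover have "set xs \<subseteq> fst G" "set ys \<subseteq> fst G"
    using xs ys by (auto simp: graph_path_def)
  ultimately have "z \<in> p ` ({a, b} \<inter> {c, d})"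
    using edges_meet_in_common_vertices[OF draw e(3) f(3)] e f by blast
  with e(2) f(2) show "z \<in> p ` (set xs \<inter> set ys)"
    by blast
qed

lemma disjoint_drawn_paths:
  assumes "plane_drawing G p \<gamma>" "graph_path G xs" "graph_path G ys" "set xs \<inter> set ys = {}"
  shows "drawn_path \<gamma> xs \<inter> drawn_path \<gamma> ys = {}"
proof -
  have "successively (\<lambda>x y. \<not> {x, y} \<subseteq> set ys) xs"
    unfolding successively_conv_nth
  proof (intro allI impI)
    fix i assume "Suc i < length xs"
    then have "xs ! i \<in> set xs"
      by simp
    with assms(4) show "\<not> {xs ! i, xs ! Suc i} \<subseteq> set ys"
      by auto
  qed
  with drawn_paths_meet_in_common_vertices[OF assms(1-3)] assms(4) show ?thesis
    by auto
qed

lemma arc_along_graph_path: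
  assumes draw: "plane_drawing G p \<gamma>" and path: "graph_path G xs"
  shows "\<exists>g. arc g \<and> pathstart g = p (hd xs) \<and> pathfinish g = p (last xs) \<and>
             path_image g = drawn_path \<gamma> xs"
  using path
proof (induction xs rule: induct_list012)
  case (3 x y zs)
  have edge: "{x, y} \<in> snd G"
    using "3.prems" by (simp add: graph_path_def)
  then have \<gamma>: "arc (\<gamma> {x, y})" "{pathstart (\<gamma> {x, y}), pathfinish (\<gamma> {x, y})} = {p x, p y}"
    using draw by (auto simp: plane_drawing_def)
  obtain g where g: "arc g" "pathstart g = p x" "pathfinish g = p y"
      "path_image g = path_image (\<gamma> {x, y})"
  proof (cases "pathstart (\<gamma> {x, y}) = p x \<and> pathfinish (\<gamma> {x, y}) = p y")
    case True
    with \<gamma> that show ?thesis by blast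
  next
    case False
    with \<gamma> that[of "reversepath (\<gamma> {x, y})"] show ?thesis
      by (auto simp: arc_reversepath doubleton_eq_iff)
  qed
  show ?case
  proof (cases zs)
    case Nil
    with g show ?thesis by auto
  next
    case (Cons z zs')
    have path: "graph_path G (y # zs)" and fresh: "x \<notin> set (y # zs)" and xy: "{x, y} \<subseteq> fst G"
      using "3.prems" Cons by (auto simp: graph_path_def)
    obtain h where h: "arc h" "pathstart h = p y" "pathfinish h = p (last (y # zs))"
        "path_image h = drawn_path \<gamma> (y # zs)"
      using "3.IH"(2)[OF path] by auto
    have "graph_path G [x, y]"
      using edge fresh xy by (auto simp: graph_path_def)
    then have "drawn_path \<gamma> [x, y] \<inter> drawn_path \<gamma> (y # zs) \<subseteq> p ` (set [x, y] \<inter> set (y # zs))"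
      using fresh by (intro drawn_paths_meet_in_common_vertices[OF draw _ path]) auto
    then have "path_image g \<inter> path_image h \<subseteq> {p y}"
      using g(4) h(4) fresh by auto
    then have "arc (g +++ h)"
      using g h by (intro arc_join) auto
    moreover have "path_image (g +++ h) = drawn_path \<gamma> (x # y # zs)"
      using g h by (subst path_image_join) auto
    ultimately show ?thesis
      using g h Cons by (intro exI[of _ "g +++ h"]) auto
  qed
qed (auto simp: graph_path_def)

lemma vertices_on_drawn_path:
  assumes "plane_drawing G p \<gamma>" "graph_path G xs"
  shows "p ` set xs \<subseteq> drawn_path \<gamma> xs"
  using assms(2)
proof (induction xs rule: induct_list012)
  case (3 x y zs)
  then have "{x, y} \<in> snd G"
    by (simp add: graph_path_def)
  then have "p ` {x, y} \<subseteq> path_image (\<gamma> {x, y})"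
    using assms(1) unfolding plane_drawing_def by blast
  moreover have "p ` set (y # zs) \<subseteq> drawn_path \<gamma> (y # zs)" if "zs \<noteq> []"
    using "3.IH"(2) "3.prems" that by (cases zs) (auto simp: graph_path_def)
  ultimately show ?case
    by (cases zs) auto
qed (auto simp: graph_path_def)

text \<open>
  A cycle with three pairwise crossing chords is a subdivision of $K_{3,3}$ with the branch vertices
  0, 2, \<open>u + 1\<close> on one side and 1, \<open>u\<close>, \<open>u + 2\<close> on the other.  The three paths from 2 to \<open>u + 1\<close>
  through 1, \<open>u\<close> and \<open>u + 2\<close> form a theta curve, and vertex 0 is joined to each of them by a path
  that avoids the other two.  When \<open>u = 3\<close> and \<open>m = 6\<close> the graph is $K_{3,3}$ itself.
\<close>

lemma cycle_with_three_crossing_chords_not_planar: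
  assumes inj: "inj_on v {..<m}" and V: "v ` {..<m} \<subseteq> fst G"
    and closed: "v m = v 0"
    and cycle: "\<And>i. i < m \<Longrightarrow> {v i, v (Suc i)} \<in> snd G"
    and chords: "{v 0, v u} \<in> snd G" "{v 1, v (u + 1)} \<in> snd G" "{v 2, v (u + 2)} \<in> snd G"
    and u: "3 \<le> u" "u + 2 < m"
  shows "\<not> planar G"
proof
  assume "planar G"
  then obtain p \<gamma> where draw: "plane_drawing G p \<gamma>"
    by (auto simp: planar_def)
  \<comment> \<open>The paths of the theta curve are \<open>P\<close>, \<open>Q\<close>, \<open>R\<close>; those from vertex 0 to them are \<open>A\<close>, \<open>B\<close>, \<open>C\<close>.\<close>
  define P where "P = map v [2, 1, u + 1]"
  define Q where "Q = map v [2..<u + 2]"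
  define R where "R = map v [2, u + 2, u + 1]"
  define A where "A = map v [0, 1]"
  define B where "B = map v [0, u]"
  define C where "C = map v (0 # rev [u + 2..<m])"
  have v_eq: "v i = v j \<longleftrightarrow> i = j" if "i < m" "j < m" for i j
    using inj that by (auto simp: inj_on_def)
  have path_if: "graph_path G (map v is)"
    if "length is \<ge> 2" "distinct is" "set is \<subseteq> {..<m}"
      "successively (\<lambda>i j. {v i, v j} \<in> snd G) is" for "is"
    using that V inj_on_subset[OF inj that(3)]
    by (auto simp: graph_path_def distinct_map successively_map)
  have paths: "graph_path G P" "graph_path G Q" "graph_path G R"
    "graph_path G A" "graph_path G B" "graph_path G C"
  proof -
    have segment: "successively (\<lambda>i j. {v i, v j} \<in> snd G) [a..<b]" if "b \<le> m" for a b
      using that cycle by (auto simp: successively_conv_nth)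
    show "graph_path G P"
      unfolding P_def using chords(2) cycle[of 1] u
      by (intro path_if) (auto simp: insert_commute numeral_2_eq_2)
    show "graph_path G Q"
      unfolding Q_def using segment[of "u + 2" 2] u by (intro path_if) auto
    show "graph_path G R"
      unfolding R_def using chords(3) cycle[of "u + 1"] u
      by (intro path_if) (auto simp: insert_commute)
    show "graph_path G A"
      unfolding A_def using cycle[of 0] u by (intro path_if) auto
    show "graph_path G B"
      unfolding B_def using chords(1) u by (intro path_if) auto
    have "rev [u + 2..<m] = (m - 1) # rev [u + 2..<m - 1]"
      using u by (cases m) auto
    moreover have "{v 0, v (m - 1)} \<in> snd G"
      using cycle[of "m - 1"] closed u by (simp add: insert_commute)
    moreover have "successively (\<lambda>i j. {v i, v j} \<in> snd G) (rev [u + 2..<m])"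
      using segment[of m] by (simp add: successively_rev insert_commute)
    ultimately show "graph_path G C"
      unfolding C_def using u by (intro path_if) auto
  qed
  have set_eqs: "set P = v ` {2, 1, u + 1}" "set Q = v ` {2..<u + 2}" "set R = v ` {2, u + 2, u + 1}"
    "set A = v ` {0, 1}" "set B = v ` {0, u}" "set C = v ` insert 0 {u + 2..<m}"
    by (auto simp: P_def Q_def R_def A_def B_def C_def)
  have ends: "hd P = v 2" "hd Q = v 2" "hd R = v 2" "hd A = v 0" "hd B = v 0" "hd C = v 0"
    "last P = v (u + 1)" "last Q = v (u + 1)" "last R = v (u + 1)"
    "last A = v 1" "last B = v u" "last C = v (u + 2)"
    using u by (auto simp: P_def Q_def R_def A_def B_def C_def hd_map last_map last_rev hd_append)
  note arcs = arc_along_graph_path[OF draw]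
  obtain g1 where g1: "arc g1" "pathstart g1 = p (v 2)" "pathfinish g1 = p (v (u + 1))"
      "path_image g1 = drawn_path \<gamma> P"
    using arcs[OF paths(1)] ends by auto
  obtain g2 where g2: "arc g2" "pathstart g2 = p (v 2)" "pathfinish g2 = p (v (u + 1))"
      "path_image g2 = drawn_path \<gamma> Q"
    using arcs[OF paths(2)] ends by auto
  obtain g3 where g3: "arc g3" "pathstart g3 = p (v 2)" "pathfinish g3 = p (v (u + 1))"
      "path_image g3 = drawn_path \<gamma> R"
    using arcs[OF paths(3)] ends by auto
  have meet: "drawn_path \<gamma> P \<inter> drawn_path \<gamma> Q \<subseteq> {p (v 2), p (v (u + 1))}"
    "drawn_path \<gamma> P \<inter> drawn_path \<gamma> R \<subseteq> {p (v 2), p (v (u + 1))}"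
    "drawn_path \<gamma> Q \<inter> drawn_path \<gamma> R \<subseteq> {p (v 2), p (v (u + 1))}"
  proof -
    note meet = drawn_paths_meet_in_common_vertices[OF draw]
    have "successively (\<lambda>x y. \<not> {x, y} \<subseteq> set Q) P" "successively (\<lambda>x y. \<not> {x, y} \<subseteq> set R) P"
      unfolding set_eqs using u by (auto simp: P_def v_eq)
    moreover have "successively (\<lambda>x y. \<not> {x, y} \<subseteq> set Q) R"
      unfolding set_eqs using u by (auto simp: R_def v_eq)
    moreover have "set P \<inter> set Q \<subseteq> {v 2, v (u + 1)}" "set P \<inter> set R \<subseteq> {v 2, v (u + 1)}"
      "set R \<inter> set Q \<subseteq> {v 2, v (u + 1)}"
      unfolding set_eqs using u by (auto simp: v_eq)
    ultimately show "drawn_path \<gamma> P \<inter> drawn_path \<gamma> Q \<subseteq> {p (v 2), p (v (u + 1))}"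
        "drawn_path \<gamma> P \<inter> drawn_path \<gamma> R \<subseteq> {p (v 2), p (v (u + 1))}"
        "drawn_path \<gamma> Q \<inter> drawn_path \<gamma> R \<subseteq> {p (v 2), p (v (u + 1))}"
      using meet[OF paths(1,2)] meet[OF paths(1,3)] meet[OF paths(3,2)] by blast+
  qed
  have reach: "connected_component (- (drawn_path \<gamma> ys \<union> drawn_path \<gamma> zs)) (p (v 0)) (p (last xs)) \<and>
      p (last xs) \<in> drawn_path \<gamma> xs"
    if xs: "graph_path G xs" "hd xs = v 0" and ys: "graph_path G ys" "set xs \<inter> set ys = {}"
      and zs: "graph_path G zs" "set xs \<inter> set zs = {}" for xs ys zs
  proof -
    obtain h where h: "arc h" "pathstart h = p (v 0)" "pathfinish h = p (last xs)"
        "path_image h = drawn_path \<gamma> xs"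
      using arcs[OF xs(1)] xs(2) by auto
    moreover have "drawn_path \<gamma> xs \<inter> (drawn_path \<gamma> ys \<union> drawn_path \<gamma> zs) = {}"
      using disjoint_drawn_paths[OF draw xs(1)] ys zs by blast
    ultimately show ?thesis
      using connected_arc_image[OF h(1)] pathstart_in_path_image[of h] pathfinish_in_path_image[of h]
      unfolding connected_component_def by auto
  qed
  have mem: "p x \<in> drawn_path \<gamma> xs" if "graph_path G xs" "x \<in> set xs" for x xs
    using vertices_on_drawn_path[OF draw that(1)] that(2) by blast
  show False
  proof (rule theta_curve_misses_an_arc[OF g1(1) g2(1) g3(1) g1(2) g2(2) g3(2) g1(3) g2(3) g3(3)])
    show "path_image g1 \<inter> path_image g2 \<subseteq> {p (v 2), p (v (u + 1))}"
      "path_image g1 \<inter> path_image g3 \<subseteq> {p (v 2), p (v (u + 1))}"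
      "path_image g2 \<inter> path_image g3 \<subseteq> {p (v 2), p (v (u + 1))}"
      using meet g1(4) g2(4) g3(4) by auto
    show "p (v 1) \<in> path_image g1" "p (v u) \<in> path_image g2" "p (v (u + 2)) \<in> path_image g3"
      unfolding g1(4) g2(4) g3(4) using u paths by (auto intro!: mem simp: set_eqs)
    have disj: "set A \<inter> set Q = {}" "set A \<inter> set R = {}" "set B \<inter> set P = {}"
      "set B \<inter> set R = {}" "set C \<inter> set P = {}" "set C \<inter> set Q = {}"
      unfolding set_eqs using u by (auto simp: v_eq)
    show "connected_component (- (path_image g2 \<union> path_image g3)) (p (v 0)) (p (v 1))"
      "connected_component (- (path_image g1 \<union> path_image g3)) (p (v 0)) (p (v u))"
      "connected_component (- (path_image g1 \<union> path_image g2)) (p (v 0)) (p (v (u + 2)))"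
      unfolding g1(4) g2(4) g3(4)
      using reach[of A Q R] reach[of B P R] reach[of C P Q] paths disj ends by auto
  qed
qed

section \<open>Planarity of subgraphs and of disjoint cycles\<close>

lemma planar_embedding:
  assumes planar: "planar H" and inj: "inj_on f (fst G)" and verts: "f ` fst G \<subseteq> fst H"
    and simple: "\<And>e. e \<in> snd G \<Longrightarrow> e \<subseteq> fst G"
    and edges: "\<And>e. e \<in> snd G \<Longrightarrow> f ` e \<in> snd H"
  shows "planar G"
proof -
  obtain p \<gamma> where draw: "plane_drawing H p \<gamma>"
    using planar by (auto simp: planar_def)
  have "plane_drawing G (p \<circ> f) (\<lambda>e. \<gamma> (f ` e))"
    unfolding plane_drawing_def
  proof (intro conjI ballI impI)
    show "inj_on (p \<circ> f) (fst G)"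
      using draw inj verts unfolding plane_drawing_def by (blast intro: comp_inj_on inj_on_subset)
  next
    fix e assume e: "e \<in> snd G"
    show "arc (\<gamma> (f ` e))"
      "{pathstart (\<gamma> (f ` e)), pathfinish (\<gamma> (f ` e))} = (p \<circ> f) ` e"
      using draw edges[OF e] unfolding plane_drawing_def by (simp_all add: image_comp)
    have restrict: "A \<inter> D = C" if "A \<inter> B = C" "C \<subseteq> D" "D \<subseteq> B" for A B C D :: "complex set"
      using that by blast
    have "path_image (\<gamma> (f ` e)) \<inter> p ` fst H = p ` f ` e"
      using draw edges[OF e] unfolding plane_drawing_def by simp
    moreover have "p ` f ` e \<subseteq> p ` f ` fst G" "p ` f ` fst G \<subseteq> p ` fst H"
      using simple[OF e] verts by (intro image_mono; simp)+
    ultimately show "path_image (\<gamma> (f ` e)) \<inter> (p \<circ> f) ` fst G = (p \<circ> f) ` e"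
      unfolding image_comp[symmetric] by (rule restrict)
  next
    fix e e' assume e: "e \<in> snd G" "e' \<in> snd G" "e \<noteq> e'"
    have "f ` e \<noteq> f ` e'"
      using e inj simple by (metis inj_on_image_eq_iff)
    then show "path_image (\<gamma> (f ` e)) \<inter> path_image (\<gamma> (f ` e')) \<subseteq> (p \<circ> f) ` e \<inter> (p \<circ> f) ` e'"
      using draw edges[OF e(1)] edges[OF e(2)] unfolding plane_drawing_def image_comp[symmetric]
      by simp
  qed
  then show ?thesis
    by (auto simp: planar_def)
qed

text \<open>
  Angles are measured in units of the $m$-th part of a full turn, so that the vertices of an inscribed
  regular $m$-gon have integer parameters.
\<close>

definition circle_point :: "nat \<Rightarrow> real \<Rightarrow> real \<Rightarrow> complex" where
  "circle_point m r t = of_real r * cis (2 * pi * t / m)"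

lemma circle_point_eq_iff:
  assumes "m > 0" "r > 0" "s > 0"
  shows "circle_point m r t = circle_point m s u \<longleftrightarrow> r = s \<and> (\<exists>k::int. t = u + k * real m)"
proof -
  have "cis (2 * pi * t / m) = cis (2 * pi * u / m) \<longleftrightarrow> (\<exists>k::int. t = u + k * real m)"
  proof -
    have "2 * pi * t / m = 2 * pi * u / m + 2 * pi * k \<longleftrightarrow> t = u + k * real m" for k :: int
    proof -
      have "2 * pi * u / m + 2 * pi * k = 2 * pi * (u + k * real m) / m"
        using assms(1) by (simp add: field_simps)
      then show ?thesis
        using assms(1) by simp
    qed
    then show ?thesis
      using sin_cos_eq_iff[of "2 * pi * t / m" "2 * pi * u / m"] by (auto simp: complex_eq_iff)
  qed
  moreover have "circle_point m r t = circle_point m s u \<longrightarrow> r = s"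
  proof
    assume "circle_point m r t = circle_point m s u"
    then have "norm (circle_point m r t) = norm (circle_point m s u)"
      by simp
    then show "r = s"
      using assms by (simp add: circle_point_def norm_mult)
  qed
  ultimately show ?thesis
    using assms by (auto simp: circle_point_def)
qed

text \<open>
  Each cycle of length \<open>m\<close> is drawn on its own circle about the origin, of radius \<open>r v\<close>, with the
  vertex of index \<open>h v\<close> at the corresponding \<open>m\<close>-th root of unity.  Infinitely many concentric circles
  cause no trouble, because only the injectivity of the radii matters, not their accumulation.  For
  \<open>m = 2\<close> a single edge occupies one of the two half circles.
\<close>

lemma disjoint_cycles_planar:
  fixes r :: "'v \<Rightarrow> real" and h :: "'v \<Rightarrow> nat"
  assumes m: "m \<ge> 2" and r: "\<And>v. v \<in> fst G \<Longrightarrow> r v > 0" and h: "\<And>v. v \<in> fst G \<Longrightarrow> h v < m"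
    and inj: "inj_on (\<lambda>v. (r v, h v)) (fst G)"
    and edges: "\<And>e. e \<in> snd G \<Longrightarrow>
      \<exists>a b. e = {a, b} \<and> a \<in> fst G \<and> b \<in> fst G \<and> r a = r b \<and> h b = Suc (h a) mod m"
  shows "planar G"
proof -
  let ?c = "circle_point m"
  define p where "p = (\<lambda>v. ?c (r v) (h v))"
  have "\<exists>a b. \<forall>e\<in>snd G. {a e, b e} = e \<and> a e \<in> fst G \<and> b e \<in> fst G \<and>
      r (b e) = r (a e) \<and> h (b e) = Suc (h (a e)) mod m"
    using edges by metis
  then obtain a b where ends: "\<And>e. e \<in> snd G \<Longrightarrow> {a e, b e} = e"
      and ab: "\<And>e. e \<in> snd G \<Longrightarrow> a e \<in> fst G \<and> b e \<in> fst G \<and>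
        r (b e) = r (a e) \<and> h (b e) = Suc (h (a e)) mod m"
    by blast
  have p_image: "p ` e = {p (a e), p (b e)}" if "e \<in> snd G" for e
    by (subst ends[OF that, symmetric]) simp
  define \<gamma> where "\<gamma> = (\<lambda>e (t::real). ?c (r (a e)) (h (a e) + t))"
  have p_eq: "p v = p w \<longleftrightarrow> v = w" if vw: "v \<in> fst G" "w \<in> fst G" for v w
  proof
    assume "p v = p w"
    then obtain k :: int where k: "r v = r w" "real (h v) = real (h w) + k * real m"
      using circle_point_eq_iff[of m "r v" "r w" "h v" "h w"] r[OF vw(1)] r[OF vw(2)] m by (auto simp: p_def)
    then have "real_of_int (int (h v)) = real_of_int (int (h w) + k * int m)"
      by simp
    then have "int (h v) = int (h w) + k * int m"
      by (simp only: of_int_eq_iff)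
    then have "int (h v) mod int m = int (h w) mod int m"
      by simp
    then have "h v = h w"
      using h vw by simp
    with k(1) inj vw show "v = w"
      by (auto simp: inj_on_def)
  qed simp
  have pb: "p (b e) = ?c (r (a e)) (h (a e) + 1)" if "e \<in> snd G" for e
  proof -
    have "\<exists>k::int. real (Suc (h (a e)) mod m) = real (h (a e)) + 1 + k * real m"
    proof
      define q where "q = Suc (h (a e)) div m"
      define l where "l = Suc (h (a e)) mod m"
      have "Suc (h (a e)) = q * m + l"
        by (simp only: q_def l_def div_mult_mod_eq)
      then have "real (Suc (h (a e))) = real q * real m + real l"
        by (simp only: of_nat_add of_nat_mult)
      then show "real (Suc (h (a e)) mod m) =
          real (h (a e)) + 1 + real_of_int (- int (Suc (h (a e)) div m)) * real m"
        by (simp flip: q_def l_def)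
    qed
    then show ?thesis
      using ab[OF that] r m by (simp add: p_def circle_point_eq_iff add_ac)
  qed
  \<comment> \<open>A vertex has an integer parameter, and conversely the only points of an arc with an integer parameter are its ends.\<close>
  have integer_point: "?c (r (a e)) s \<in> p ` e"
    if e: "e \<in> snd G" and s: "s \<in> {real (h (a e))..h (a e) + 1}" and "s \<in> \<int>" for e and s :: real
  proof -
    have "s = h (a e) \<or> s = h (a e) + 1"
    proof -
      obtain i where "s = of_int i"
        using \<open>s \<in> \<int>\<close> by (auto elim: Ints_cases)
      moreover from this s have "real_of_int (int (h (a e))) \<le> real_of_int i"
          "real_of_int i \<le> real_of_int (int (h (a e)) + 1)"
        by auto
      then have "int (h (a e)) \<le> i" "i \<le> int (h (a e)) + 1"
        by (simp_all only: of_int_le_iff)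
      then have "i = int (h (a e)) \<or> i = int (h (a e)) + 1"
        by linarith
      ultimately show ?thesis
        by auto
    qed
    then have "?c (r (a e)) s = p (a e) \<or> ?c (r (a e)) s = p (b e)"
      using pb[OF e] by (auto simp: p_def)
    then show ?thesis
      using p_image[OF e] by auto
  qed
  have on_arc: "\<exists>s::real. s \<in> {real (h (a e))..h (a e) + 1} \<and> z = ?c (r (a e)) s" if "z \<in> path_image (\<gamma> e)" for z e
  proof -
    from that obtain t where "t \<in> {0..1}" "z = \<gamma> e t"
      by (auto simp: path_image_def)
    then show ?thesis
      by (intro exI[of _ "h (a e) + t"]) (auto simp: \<gamma>_def)
  qed
  have arc_ends: "pathstart (\<gamma> e) = p (a e)" "pathfinish (\<gamma> e) = p (b e)" if "e \<in> snd G" for e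
    using pb[OF that] by (auto simp: pathstart_def pathfinish_def \<gamma>_def p_def add.commute)
  have ends_on_arc: "p ` e \<subseteq> path_image (\<gamma> e)" if "e \<in> snd G" for e
    using arc_ends[OF that] p_image[OF that] pathstart_in_path_image[of "\<gamma> e"]
      pathfinish_in_path_image[of "\<gamma> e"] by simp
  have "plane_drawing G p \<gamma>"
    unfolding plane_drawing_def
  proof (intro conjI ballI impI)
    show "inj_on p (fst G)"
      using p_eq by (auto simp: inj_on_def)
  next
    fix e assume e: "e \<in> snd G"
    show "{pathstart (\<gamma> e), pathfinish (\<gamma> e)} = p ` e"
      using arc_ends[OF e] p_image[OF e] by simp
    show "arc (\<gamma> e)"
      unfolding arc_def
    proof
      show "path (\<gamma> e)"
        unfolding path_def \<gamma>_def circle_point_def by (intro continuous_intros) (use m in auto)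
      show "inj_on (\<gamma> e) {0..1}"
      proof (rule inj_onI)
        fix s t :: real assume st: "s \<in> {0..1}" "t \<in> {0..1}" "\<gamma> e s = \<gamma> e t"
        then obtain k :: int where k: "s = t + k * real m"
          using circle_point_eq_iff[of m "r (a e)" "r (a e)"] r ab[OF e] m
          by (auto simp: \<gamma>_def)
        have "\<bar>k\<bar> * real m < 1 * real m"
        proof -
          have "\<bar>k\<bar> * real m = \<bar>s - t\<bar>"
            using k by (simp add: abs_mult)
          also have "\<dots> \<le> 1"
            using st by auto
          also have "\<dots> < 1 * real m"
            using m by simp
          finally show ?thesis .
        qed
        then have "k = 0"
          using m by (simp only: mult_less_cancel_right) auto
        with k show "s = t" by simp
      qed
    qed
    show "path_image (\<gamma> e) \<inter> p ` fst G = p ` e"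
    proof
      show "p ` e \<subseteq> path_image (\<gamma> e) \<inter> p ` fst G"
        using ends_on_arc[OF e] p_image[OF e] ab[OF e] by simp
      show "path_image (\<gamma> e) \<inter> p ` fst G \<subseteq> p ` e"
      proof
        fix z assume z: "z \<in> path_image (\<gamma> e) \<inter> p ` fst G"
        then obtain s v where s: "s \<in> {real (h (a e))..h (a e) + 1}" "z = ?c (r (a e)) s"
            and v: "v \<in> fst G" "z = p v"
          using on_arc by blast
        then obtain k :: int where "s = real (h v) + k * real m"
          using circle_point_eq_iff[of m "r (a e)" "r v" s "h v"] r ab[OF e] m by (auto simp: p_def)
        then have "s \<in> \<int>"
          by simp
        with integer_point[OF e s(1)] s(2) show "z \<in> p ` e"
          by simp
      qed
    qed
  next
    fix e f assume e: "e \<in> snd G" and f: "f \<in> snd G" and "e \<noteq> f"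
    show "path_image (\<gamma> e) \<inter> path_image (\<gamma> f) \<subseteq> p ` e \<inter> p ` f"
    proof
      fix z assume "z \<in> path_image (\<gamma> e) \<inter> path_image (\<gamma> f)"
      then obtain s t where s: "s \<in> {real (h (a e))..h (a e) + 1}" "z = ?c (r (a e)) s"
          and t: "t \<in> {real (h (a f))..h (a f) + 1}" "z = ?c (r (a f)) t"
        using on_arc by blast
      then obtain k :: int where k: "r (a e) = r (a f)" "s = t + k * real m"
        using circle_point_eq_iff[of m "r (a e)" "r (a f)" s t] r ab[OF e] ab[OF f] m by auto
      show "z \<in> p ` e \<inter> p ` f"
      proof (cases "s \<in> \<int>")
        case True
        then have "t \<in> \<int>"
          using k(2) by (metis Ints_diff Ints_mult Ints_of_int Ints_of_nat add_diff_cancel_right')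
        with True show ?thesis
          using integer_point[OF e s(1)] integer_point[OF f t(1)] s(2) t(2) by simp
      next
        case False
        \<comment> \<open>Here the integer part of the parameter recovers the starting vertex, hence the edge.\<close>
        have "\<lfloor>s\<rfloor> = int (h (a e))"
          using s(1) False by (intro floor_unique) (auto simp: less_le)
        moreover have "t \<notin> \<int>"
          using k(2) False by auto
        then have "\<lfloor>t\<rfloor> = int (h (a f))"
          using t(1) by (intro floor_unique) (auto simp: less_le)
        moreover have "\<lfloor>s\<rfloor> = \<lfloor>t\<rfloor> + k * int m"
          using k(2) by (metis floor_add_int of_int_mult of_int_of_nat_eq)
        ultimately have "int (h (a f)) + k * int m = int (h (a e))"
          by simp
        then have "int (h (a e)) mod int m = int (h (a f)) mod int m"
          by (metis mod_mult_self1)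
        then have "h (a e) = h (a f)"
          using h ab[OF e] ab[OF f] by simp
        then have "a e = a f" "b e = b f"
          using inj k(1) ab[OF e] ab[OF f] by (auto simp: inj_on_def)
        then have "e = f"
          using ends[OF e] ends[OF f] by metis
        with \<open>e \<noteq> f\<close> show ?thesis ..
      qed
    qed
  qed
  then show ?thesis
    by (auto simp: planar_def)
qed

section \<open>Square roots of 1 modulo an integer\<close>

text \<open>
  In the coefficient of index \<open>k\<close> of the square, every product except the two equal ones with
  \<open>u 0\<close> is divisible by \<open>q\<close> by induction, so \<open>q\<close> divides \<open>2 * u 0 * u k\<close>; and \<open>2 * u 0\<close> is a unit,
  since \<open>u 0 * u 0\<close> is 1 modulo \<open>q\<close>.
\<close>

lemma higher_coefficients_vanish_mod_odd:
  fixes u :: "nat \<Rightarrow> int"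
  assumes square: "\<And>k. [(\<Sum>i\<le>k. u i * u (k - i)) = (if k = 0 then 1 else 0)] (mod q)"
    and "odd q" "k > 0"
  shows "q dvd u k"
  using \<open>k > 0\<close>
proof (induction k rule: less_induct)
  case (less k)
  have "[1 = u 0 * u 0] (mod q)"
    using square[of 0] by (simp add: cong_sym)
  then have "coprime (u 0 * u 0) q"
    by (rule cong_imp_coprime) simp
  then have coprime: "coprime q (2 * u 0)"
    using \<open>odd q\<close> by (simp add: coprime_commute)
  obtain l where l: "k = Suc l"
    using less.prems by (cases k) auto
  have "(\<Sum>i\<le>k. u i * u (k - i)) = u 0 * u k + (\<Sum>i\<in>{1..l}. u i * u (k - i)) + u k * u 0"
  proof -
    have "{..k} = insert 0 (insert k {1..l})"
      using l by auto
    then show ?thesis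
      using l by simp
  qed
  moreover have "q dvd (\<Sum>i\<in>{1..l}. u i * u (k - i))"
    using less.IH l by (intro dvd_sum dvd_mult2) auto
  moreover have "q dvd (\<Sum>i\<le>k. u i * u (k - i))"
    using square[of k] l by (simp add: cong_0_iff)
  ultimately have "q dvd (u 0 * u k + u k * u 0)"
    by (simp add: dvd_add_left_iff add.commute add.left_commute)
  then have "q dvd 2 * u 0 * u k"
    by (simp add: mult_ac)
  with coprime show ?case
    by (metis coprime_dvd_mult_right_iff)
qed

text \<open>
  Modulo 2 the products cancel in pairs under \<open>i\<close> to \<open>2 * k - i\<close>, except the middle one: squaring is
  additive in characteristic 2.
\<close>

lemma higher_coefficients_even:
  fixes u :: "nat \<Rightarrow> int"
  assumes square: "even (\<Sum>i\<le>2 * k. u i * u (2 * k - i))"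
  shows "even (u k)"
proof -
  let ?t = "\<lambda>i. u i * u (2 * k - i)"
  have "{..2 * k} = {..<k} \<union> insert k {k<..2 * k}"
    by auto
  then have "sum ?t {..2 * k} = sum ?t {..<k} + sum ?t (insert k {k<..2 * k})"
    by (simp only: ) (intro sum.union_disjoint; auto)
  also have "sum ?t {k<..2 * k} = sum ?t {..<k}"
    by (rule sum.reindex_bij_witness[of _ "\<lambda>i. 2 * k - i" "\<lambda>i. 2 * k - i"]) auto
  then have "sum ?t (insert k {k<..2 * k}) = u k * u k + sum ?t {..<k}"
    by (simp add: mult_2)
  finally show ?thesis
    using square by simp
qed

text \<open>
  Every polynomial square root of 1 modulo \<open>m\<close> is constant unless 4 divides \<open>m\<close>.  Split \<open>m\<close> into an odd
  number and at most one factor 2: the odd part is handled by induction from the bottom, the prime 2 by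
  the Frobenius map.
\<close>

lemma higher_coefficients_vanish:
  fixes u :: "nat \<Rightarrow> int" and m :: int
  assumes square: "\<And>k. [(\<Sum>i\<le>k. u i * u (k - i)) = (if k = 0 then 1 else 0)] (mod m)"
    and m: "\<not> 4 dvd m" and "k > 0"
  shows "m dvd u k"
proof (cases "even m")
  case False
  with higher_coefficients_vanish_mod_odd[OF square] \<open>k > 0\<close> show ?thesis
    by blast
next
  case True
  then obtain q where q: "m = 2 * q"
    by blast
  with m have "odd q"
    by auto
  have mod_q: "[(\<Sum>i\<le>j. u i * u (j - i)) = (if j = 0 then 1 else 0)] (mod q)" for j
    using square[of j] q by (metis cong_modulus_mult mult.commute)
  have "q dvd u k"
    by (rule higher_coefficients_vanish_mod_odd[OF mod_q \<open>odd q\<close> \<open>k > 0\<close>])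
  moreover have "even (u k)"
  proof (rule higher_coefficients_even)
    have "m dvd (\<Sum>i\<le>2 * k. u i * u (2 * k - i))"
      using square[of "2 * k"] \<open>k > 0\<close> by (simp add: cong_0_iff)
    then show "even (\<Sum>i\<le>2 * k. u i * u (2 * k - i))"
      using True dvd_trans by blast
  qed
  moreover have "coprime q 2"
    using \<open>odd q\<close> by simp
  ultimately show ?thesis
    unfolding q by (simp add: divides_mult coprime_commute)
qed

text \<open>
  Among the $n \<ge> 2$ these are the ones not divisible by 4 modulo which 1 and $-1$ are the only square
  roots of 1.
\<close>

definition odd_prime_power_or_double :: "nat \<Rightarrow> bool" where
  "odd_prime_power_or_double n \<longleftrightarrow>
     n = 2 \<or> (\<exists>p k. prime p \<and> odd p \<and> k > 0 \<and> (n = p ^ k \<or> n = 2 * p ^ k))"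

lemma involution_mod_odd_prime_power:
  fixes a :: int and p k :: nat
  assumes "prime p" "odd p" and a: "int (p ^ k) dvd (a - 1) * (a + 1)"
  shows "int (p ^ k) dvd a - 1 \<or> int (p ^ k) dvd a + 1"
proof (cases "int p dvd a - 1")
  case True
  have "\<not> int p dvd a + 1"
  proof
    assume "int p dvd a + 1"
    with True have "int p dvd (a + 1) - (a - 1)"
      by (rule dvd_diff[rotated])
    then have "int p dvd int 2"
      by simp
    then have "p dvd 2"
      by (simp only: int_dvd_int_iff)
    with assms(1,2) show False
      by (metis even_iff_mod_2_eq_zero dvd_refl primes_dvd_imp_eq two_is_prime_nat)
  qed
  then have "coprime (int (p ^ k)) (a + 1)"
    using assms(1) by (simp add: prime_imp_coprime coprime_power_left_iff)
  with a show ?thesis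
    by (simp add: coprime_dvd_mult_left_iff)
next
  case False
  then have "coprime (int (p ^ k)) (a - 1)"
    using assms(1) by (simp add: prime_imp_coprime coprime_power_left_iff)
  with a show ?thesis
    by (simp add: coprime_dvd_mult_right_iff)
qed

lemma involution_trivial:
  fixes a :: int
  assumes n: "odd_prime_power_or_double n" and a: "[a * a = 1] (mod int n)"
  shows "[a = 1] (mod int n) \<or> [a = - 1] (mod int n)"
proof -
  have dvd: "int n dvd (a - 1) * (a + 1)"
    using a by (simp add: cong_iff_dvd_diff algebra_simps)
  have "int n dvd a - 1 \<or> int n dvd a + 1"
  proof (cases "n = 2")
    case True
    with dvd show ?thesis
      by auto
  next
    case False
    then obtain p k where p: "prime p" "odd p" "n = p ^ k \<or> n = 2 * p ^ k"
      using n by (auto simp: odd_prime_power_or_double_def)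
    then have "int (p ^ k) dvd int n"
      by auto
    then have one: "int (p ^ k) dvd a - 1 \<or> int (p ^ k) dvd a + 1"
      using involution_mod_odd_prime_power[OF p(1,2)] dvd dvd_trans by blast
    from p(3) show ?thesis
    proof
      assume "n = p ^ k"
      with one show ?thesis by simp
    next
      assume n: "n = 2 * p ^ k"
      then have "even ((a - 1) * (a + 1))"
        using dvd by (metis dvd_trans dvd_triv_left int_dvd_int_iff of_nat_numeral)
      then have "even (a - 1)" "even (a + 1)"
        by auto
      moreover have "coprime 2 (int (p ^ k))"
        using p(2) by simp
      ultimately show ?thesis
        using one unfolding n by (auto simp: divides_mult)
    qed
  qed
  then show ?thesis
    by (auto simp: cong_iff_dvd_diff)
qed

text \<open>
  If 4 divides $n > 4$, then $1 + n/2$ is a square root of 1 other than $\pm 1$.  Otherwise $n$ has an odd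
  prime divisor and, not being of the special form, factors as $ab$ with coprime $a, b \<ge> 3$; the
  Chinese remainder theorem then gives a number that is 1 modulo $a$ and $-1$ modulo $b$, and
  $1 \<noteq> -1$ modulo either factor.
\<close>

lemma nontrivial_involution:
  assumes n: "n \<ge> 2" "n \<noteq> 4" "\<not> odd_prime_power_or_double n"
  shows "\<exists>u::int. [u * u = 1] (mod int n) \<and> \<not> [u = 1] (mod int n) \<and> \<not> [u = - 1] (mod int n)"
proof (cases "4 dvd n")
  case True
  then obtain j where j: "n = 4 * j"
    by blast
  with n have "j \<ge> 2"
    by auto
  have "(1 + 2 * int j) * (1 + 2 * int j) - 1 = int n * (1 + int j)"
    by (simp add: j algebra_simps)
  then have "[(1 + 2 * int j) * (1 + 2 * int j) = 1] (mod int n)"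
    by (metis cong_iff_dvd_diff dvd_triv_left)
  moreover have "\<not> [1 + 2 * int j = 1] (mod int n)" "\<not> [1 + 2 * int j = - 1] (mod int n)"
    using \<open>j \<ge> 2\<close> zdvd_imp_le[of "int n" "2 * int j"] zdvd_imp_le[of "int n" "2 + 2 * int j"]
    by (auto simp: j cong_iff_dvd_diff)
  ultimately show ?thesis
    by blast
next
  case False
  have "\<exists>p. prime p \<and> odd p \<and> p dvd n"
  proof -
    define q where "q = (if even n then n div 2 else n)"
    have q: "odd q" "q dvd n" "q \<noteq> 1"
      using False n by (auto simp: q_def odd_prime_power_or_double_def elim!: evenE)
    then obtain p where "prime p" "p dvd q"
      using prime_factor_nat by blast
    with q show ?thesis
      by (meson dvd_trans)
  qed
  then obtain p where p: "prime p" "odd p" "p dvd n"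
    by blast
  obtain b where b: "n = p ^ multiplicity p n * b" "\<not> p dvd b"
    using multiplicity_decompose'[of n p] n p(1) by (metis not_prime_unit not_numeral_le_zero)
  define a where "a = p ^ multiplicity p n"
  have k: "multiplicity p n > 0"
    using p n by (simp add: prime_multiplicity_gt_zero_iff)
  have a: "a \<ge> 3"
  proof -
    have "p \<ge> 3"
      using p prime_ge_2_nat[of p] by (cases "p = 2") auto
    also have "p \<le> a"
      using k p(1) prime_gt_0_nat[of p] by (simp add: a_def self_le_power)
    finally show ?thesis .
  qed
  have "n \<noteq> a \<and> n \<noteq> 2 * a"
    using n(3) p k unfolding odd_prime_power_or_double_def a_def by blast
  moreover have "n = a * b"
    using b(1) by (simp add: a_def)
  moreover have "b \<noteq> 0"
    using \<open>n = a * b\<close> n(1) by (metis mult_0_right not_numeral_le_zero)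
  ultimately have "b \<noteq> 0" "b \<noteq> 1" "b \<noteq> 2"
    by auto
  then have "b \<ge> 3"
    by auto
  have n_eq: "int n = int a * int b"
    using \<open>n = a * b\<close> by simp
  have coprime: "coprime (int a) (int b)"
    using p(1) b(2) by (simp add: a_def prime_imp_coprime coprime_power_left_iff)
  then obtain u where u: "[u = 1] (mod int a)" "[u = - 1] (mod int b)"
    using binary_chinese_remainder_int by blast
  have "[u * u = 1] (mod int a)" "[u * u = 1] (mod int b)"
    using cong_mult[OF u(1) u(1)] cong_mult[OF u(2) u(2)] by simp_all
  then have "[u * u = 1] (mod int n)"
    unfolding n_eq using coprime by (rule coprime_cong_mult)
  moreover have "\<not> [u = 1] (mod int n)"
  proof
    assume "[u = 1] (mod int n)"
    then have "[u = 1] (mod int b)"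
      unfolding n_eq by (metis cong_modulus_mult mult.commute)
    with u(2) have "[1 = - 1] (mod int b)"
      by (metis cong_sym cong_trans)
    then show False
      using \<open>b \<ge> 3\<close> zdvd_imp_le[of "int b" 2] by (auto simp: cong_iff_dvd_diff)
  qed
  moreover have "\<not> [u = - 1] (mod int n)"
  proof
    assume "[u = - 1] (mod int n)"
    then have "[u = - 1] (mod int a)"
      unfolding n_eq by (metis cong_modulus_mult)
    with u(1) have "[1 = - 1] (mod int a)"
      by (metis cong_sym cong_trans)
    then show False
      using a zdvd_imp_le[of "int a" 2] by (auto simp: cong_iff_dvd_diff)
  qed
  ultimately show ?thesis
    by blast
qed

section \<open>Involutory Cayley graphs of residue rings and their polynomial rings\<close>

text \<open>
  An injective ring homomorphism preserves square roots of 1, hence embeds the involutory Cayley graph.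
\<close>

lemma planar_of_injective_ring_hom:
  assumes "ring R" "ring S" and h: "h \<in> ring_hom R S" and inj: "inj_on h (carrier R)"
    and planar: "planar (involutory_cayley_graph S)"
  shows "planar (involutory_cayley_graph R)"
proof (rule planar_embedding[OF planar, of h])
  interpret ring_hom_ring R S h
    using assms by (intro ring_hom_ringI2)
  show "inj_on h (fst (involutory_cayley_graph R))"
    using inj by (simp add: involutory_cayley_graph_def)
  show "h ` fst (involutory_cayley_graph R) \<subseteq> fst (involutory_cayley_graph S)"
    by (auto simp: involutory_cayley_graph_def)
  fix e assume "e \<in> snd (involutory_cayley_graph R)"
  then obtain a b where e: "e = {a, b}" "a \<in> carrier R" "b \<in> carrier R" "a \<noteq> b"
      "(a \<ominus>\<^bsub>R\<^esub> b) [^]\<^bsub>R\<^esub> (2::nat) = \<one>\<^bsub>R\<^esub>"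
    by (auto simp: involutory_cayley_graph_def)
  then show "e \<subseteq> fst (involutory_cayley_graph R)"
    by (auto simp: involutory_cayley_graph_def)
  have "h ((a \<ominus>\<^bsub>R\<^esub> b) [^]\<^bsub>R\<^esub> (2::nat)) = (h a \<ominus>\<^bsub>S\<^esub> h b) [^]\<^bsub>S\<^esub> (2::nat)"
    using e(2,3) by (simp add: numeral_2_eq_2 a_minus_def)
  then have "(h a \<ominus>\<^bsub>S\<^esub> h b) [^]\<^bsub>S\<^esub> (2::nat) = \<one>\<^bsub>S\<^esub>"
    using e(5) by simp
  moreover have "h a \<noteq> h b"
    using inj e by (auto simp: inj_on_def)
  moreover have "h a \<in> carrier S" "h b \<in> carrier S"
    using e(2,3) by simp_all
  ultimately show "h ` e \<in> snd (involutory_cayley_graph S)"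
    unfolding e(1) involutory_cayley_graph_def by (simp, blast)
qed

context residues
begin

lemma finsum_eq_sum_mod:
  assumes "finite A" "\<And>i. i \<in> A \<Longrightarrow> f i \<in> carrier R"
  shows "(\<Oplus>i\<in>A. f i) = (\<Sum>i\<in>A. f i) mod m"
proof -
  interpret cring R
    by (rule cring)
  show ?thesis
    using assms
  proof (induction A)
    case empty
    show ?case
      by (simp add: res_zero_eq)
  next
    case (insert i A)
    then show ?case
      by (simp add: Pi_def res_add_eq mod_simps)
  qed
qed

lemma minus_eq_mod: "x \<ominus> y = (x - y) mod m"
  by (simp add: a_minus_def res_neg_eq res_add_eq mod_simps)

lemma UP_minus_coefficient:
  assumes "f \<in> carrier (UP R)" "g \<in> carrier (UP R)"
  shows "(f \<ominus>\<^bsub>UP R\<^esub> g) k = (f k - g k) mod m"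
proof -
  interpret R: cring R
    by (rule cring)
  interpret UP_cring R "UP R"
    by unfold_locales simp
  have "coeff (UP R) (f \<ominus>\<^bsub>UP R\<^esub> g) k = coeff (UP R) f k \<ominus> coeff (UP R) g k"
    using assms by (rule coeff_minus)
  moreover have "coeff (UP R) h = h" if "h \<in> carrier (UP R)" for h
    using that by (simp add: UP_def)
  ultimately show ?thesis
    using assms by (simp add: minus_eq_mod)
qed

lemma UP_square_eq_one_iff:
  assumes u: "u \<in> carrier (UP R)"
  shows "u [^]\<^bsub>UP R\<^esub> (2::nat) = \<one>\<^bsub>UP R\<^esub> \<longleftrightarrow>
    (\<forall>k. [(\<Sum>i\<le>k. u i * u (k - i)) = (if k = 0 then 1 else 0)] (mod m))"
proof -
  interpret R: cring R
    by (rule cring)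
  interpret UP_cring R "UP R"
    by unfold_locales simp
  have u': "u k \<in> carrier R" "u \<in> up R" for k
    using u by (auto simp: UP_def)
  have "(u \<otimes>\<^bsub>UP R\<^esub> u) k = (\<Sum>i\<le>k. u i * u (k - i)) mod m" for k
  proof -
    have "(u \<otimes>\<^bsub>UP R\<^esub> u) k = (\<Oplus>i\<in>{..k}. u i \<otimes> u (k - i))"
      using u'(2) by (simp add: UP_def)
    also have "\<dots> = (\<Sum>i\<le>k. u i \<otimes> u (k - i)) mod m"
      using u'(1) by (intro finsum_eq_sum_mod) auto
    also have "\<dots> = (\<Sum>i\<le>k. u i * u (k - i)) mod m"
      by (simp add: res_mult_eq mod_sum_eq)
    finally show ?thesis .
  qed
  moreover have "u [^]\<^bsub>UP R\<^esub> (2::nat) = u \<otimes>\<^bsub>UP R\<^esub> u"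
    using u by (simp add: numeral_2_eq_2)
  moreover have "\<one>\<^bsub>UP R\<^esub> k = (if k = 0 then 1 else 0)" for k
    by (simp add: UP_def res_one_eq res_zero_eq)
  ultimately show ?thesis
    using m_gt_one by (auto simp: fun_eq_iff cong_def)
qed

text \<open>
  Adjacency in terms of the integer differences of the coefficients, without reduction modulo \<open>m\<close>, so
  that the integer lemmas on square roots of 1 apply to them directly.
\<close>

lemma UP_involutory_edge_iff:
  assumes "f \<in> carrier (UP R)" "g \<in> carrier (UP R)"
  defines "d \<equiv> \<lambda>k. f k - g k"
  shows "{f, g} \<in> snd (involutory_cayley_graph (UP R)) \<longleftrightarrow>
    (\<forall>k. [(\<Sum>i\<le>k. d i * d (k - i)) = (if k = 0 then 1 else 0)] (mod m))"
proof -
  interpret R: cring R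
    by (rule cring)
  interpret UP_cring R "UP R"
    by unfold_locales simp
  have square: "(f \<ominus>\<^bsub>UP R\<^esub> g) [^]\<^bsub>UP R\<^esub> (2::nat) = \<one>\<^bsub>UP R\<^esub> \<longleftrightarrow>
      (\<forall>k. [(\<Sum>i\<le>k. (f i - g i) * (f (k - i) - g (k - i))) = (if k = 0 then 1 else 0)] (mod m))"
    if fg: "f \<in> carrier (UP R)" "g \<in> carrier (UP R)" for f g
  proof -
    have "(\<Sum>i\<le>k. ((f i - g i) mod m) * ((f (k - i) - g (k - i)) mod m)) mod m =
        (\<Sum>i\<le>k. (f i - g i) * (f (k - i) - g (k - i))) mod m" for k
    proof -
      have "(\<Sum>i\<le>k. ((f i - g i) mod m) * ((f (k - i) - g (k - i)) mod m)) mod m =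
        (\<Sum>i\<le>k. ((f i - g i) mod m) * ((f (k - i) - g (k - i)) mod m) mod m) mod m"
        by (rule mod_sum_eq[symmetric])
      also have "\<dots> = (\<Sum>i\<le>k. (f i - g i) * (f (k - i) - g (k - i)) mod m) mod m"
        by (simp only: mod_mult_eq)
      also have "\<dots> = (\<Sum>i\<le>k. (f i - g i) * (f (k - i) - g (k - i))) mod m"
        by (rule mod_sum_eq)
      finally show ?thesis .
    qed
    then show ?thesis
      using fg by (subst UP_square_eq_one_iff) (simp_all add: UP_minus_coefficient cong_def)
  qed
  have sym: "(\<Sum>i\<le>k. (g i - f i) * (g (k - i) - f (k - i))) = (\<Sum>i\<le>k. d i * d (k - i))" for k
    unfolding d_def by (intro sum.cong) (auto simp: algebra_simps)
  let ?D = "\<forall>k. [(\<Sum>i\<le>k. d i * d (k - i)) = (if k = 0 then 1 else 0)] (mod m)"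
  have "{f, g} \<in> snd (involutory_cayley_graph (UP R)) \<longleftrightarrow>
      f \<noteq> g \<and> ((f \<ominus>\<^bsub>UP R\<^esub> g) [^]\<^bsub>UP R\<^esub> (2::nat) = \<one>\<^bsub>UP R\<^esub> \<or>
        (g \<ominus>\<^bsub>UP R\<^esub> f) [^]\<^bsub>UP R\<^esub> (2::nat) = \<one>\<^bsub>UP R\<^esub>)"
    using assms(1,2) unfolding involutory_cayley_graph_def by (auto simp: doubleton_eq_iff)
  also have "\<dots> \<longleftrightarrow> f \<noteq> g \<and> ?D"
    unfolding square[OF assms(1,2)] square[OF assms(2,1)] sym by (simp add: d_def)
  also have "\<dots> \<longleftrightarrow> ?D"
  proof -
    have "f \<noteq> g" if ?D
    proof
      assume "f = g"
      with that[rule_format, of 0] m_gt_one show False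
        by (simp add: d_def cong_def)
    qed
    then show ?thesis
      by blast
  qed
  finally show ?thesis .
qed

lemma involutory_edge:
  assumes "[(x - y) * (x - y) = 1] (mod m)"
  shows "{x mod m, y mod m} \<in> snd (involutory_cayley_graph R)"
proof -
  interpret R: cring R
    by (rule cring)
  have car: "x mod m \<in> carrier R" "y mod m \<in> carrier R"
    using m_gt_one by (auto simp: res_carrier_eq)
  have "x mod m \<noteq> y mod m"
  proof
    assume "x mod m = y mod m"
    then have "(x - y) * (x - y) mod m = 0"
      by (simp add: mod_eq_dvd_iff)
    with assms m_gt_one show False
      by (simp add: cong_def)
  qed
  moreover have "(x mod m \<ominus> y mod m) [^] (2::nat) = \<one>"
  proof -
    have "(x mod m \<ominus> y mod m) [^] (2::nat) = (x - y) * (x - y) mod m"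
      by (simp add: numeral_2_eq_2 minus_eq_mod res_mult_eq res_one_eq mod_simps)
    with assms m_gt_one show ?thesis
      by (simp add: cong_def res_one_eq)
  qed
  ultimately show ?thesis
    using car by (auto simp: involutory_cayley_graph_def)
qed

end

text \<open>
  The only square roots of 1 are the constants $\pm 1$, so the edges join polynomials that agree in
  every coefficient of positive degree and whose constant terms are consecutive.  Hence the polynomials
  with the same higher coefficients span a cycle of length \<open>n\<close> (a single edge if \<open>n = 2\<close>) indexed by the
  constant term.  There are countably many such cycles, and an enumeration of the tuples of higher
  coefficients provides distinct radii for them.
\<close>

lemma UP_residue_ring_planar:
  assumes "n \<ge> 2" and n: "odd_prime_power_or_double n"
  shows "planar (involutory_cayley_graph (UP (residue_ring (int n))))"
proof -
  define R where "R = residue_ring (int n)"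
  interpret residues "int n" R
    using assms(1) by (unfold_locales) (auto simp: R_def)
  have "\<not> 4 dvd n"
  proof
    assume "4 dvd n"
    moreover have "n \<noteq> 2" if "4 dvd n"
      using that by auto
    ultimately obtain p k where p: "odd p" "n = p ^ k \<or> n = 2 * p ^ k"
      using n by (auto simp: odd_prime_power_or_double_def)
    have "even (p ^ k)"
      using p(2) \<open>4 dvd n\<close> by presburger
    with p(1) show False
      by simp
  qed
  then have not4: "\<not> 4 dvd int n"
    by presburger
  define T :: "(nat \<Rightarrow> int) \<Rightarrow> nat \<Rightarrow> int" where "T = (\<lambda>f k. f (Suc k))"
  define S where "S = T ` carrier (UP R)"
  have "countable S"
  proof (rule countable_subset)
    let ?F = "\<lambda>xs k. if k < length xs then xs ! k else (0::int)"
    show "countable (range ?F)"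
      by simp
    show "S \<subseteq> range ?F"
    proof
      fix g assume "g \<in> S"
      then obtain f where f: "f \<in> up R" "g = T f"
        by (auto simp: S_def UP_def)
      then obtain N where "bound \<zero>\<^bsub>R\<^esub> N f"
        by (auto simp: up_def)
      then have "g = ?F (map g [0..<N])"
        using f(2) by (auto simp: T_def res_zero_eq fun_eq_iff bound_def)
      then show "g \<in> range ?F"
        by blast
    qed
  qed
  have range: "0 \<le> f k" "f k < int n" if "f \<in> carrier (UP R)" for f k
    using that mem_upD[of f R k] by (auto simp: UP_def res_carrier_eq)
  define r where "r = (\<lambda>f. 1 + real (to_nat_on S (T f)))"
  have G: "fst (involutory_cayley_graph (UP R)) = carrier (UP R)"
    by (simp add: involutory_cayley_graph_def)
  have "planar (involutory_cayley_graph (UP R))"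
  proof (rule disjoint_cycles_planar[OF assms(1)])
    show "r f > 0" for f
      by (simp add: r_def)
    show "nat (f 0) < n" if "f \<in> fst (involutory_cayley_graph (UP R))" for f
      using that range[of f 0] assms(1) by (simp add: G nat_less_iff)
    show "inj_on (\<lambda>f. (r f, nat (f 0))) (fst (involutory_cayley_graph (UP R)))"
      unfolding G
    proof (rule inj_onI)
      fix f g assume fg: "f \<in> carrier (UP R)" "g \<in> carrier (UP R)"
        and eq: "(r f, nat (f 0)) = (r g, nat (g 0))"
      have "T f = T g"
        using inj_on_to_nat_on[OF \<open>countable S\<close>] fg eq by (auto simp: inj_on_def S_def r_def)
      then have "f (Suc k) = g (Suc k)" for k
        by (simp add: T_def fun_eq_iff)
      moreover have "f 0 = g 0"
        using eq range[OF fg(1)] range[OF fg(2)] by (simp add: eq_nat_nat_iff)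
      ultimately have "f k = g k" for k
        by (cases k) simp_all
      then show "f = g"
        by (rule ext)
    qed
    fix e assume "e \<in> snd (involutory_cayley_graph (UP R))"
    moreover from this obtain f g where e: "e = {f, g}" "f \<in> carrier (UP R)" "g \<in> carrier (UP R)"
      by (auto simp: involutory_cayley_graph_def)
    ultimately have square: "[(\<Sum>i\<le>k. (f i - g i) * (f (k - i) - g (k - i))) = (if k = 0 then 1 else 0)] (mod int n)" for k
      using UP_involutory_edge_iff[of f g] by blast
    have "f k = g k" if "k > 0" for k
    proof -
      have "int n dvd f k - g k"
        using higher_coefficients_vanish[of "\<lambda>k. f k - g k", OF square not4 that] .
      then have "[f k = g k] (mod int n)"
        by (simp add: cong_iff_dvd_diff)
      then show ?thesis
        using range[OF e(2), of k] range[OF e(3), of k] by (simp add: cong_def)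
    qed
    then have T: "T f = T g"
      by (simp add: T_def)
    have "[(f 0 - g 0) * (f 0 - g 0) = 1] (mod int n)"
      using square[of 0] by simp
    then have "[f 0 - g 0 = 1] (mod int n) \<or> [f 0 - g 0 = - 1] (mod int n)"
      by (rule involution_trivial[OF n])
    then have "[f 0 = g 0 + 1] (mod int n) \<or> [g 0 = f 0 + 1] (mod int n)"
    proof
      assume "[f 0 - g 0 = 1] (mod int n)"
      from cong_add[OF this cong_refl[of "g 0"]] show ?thesis
        by (simp add: add.commute)
    next
      assume "[f 0 - g 0 = - 1] (mod int n)"
      from cong_sym[OF cong_add[OF this cong_refl[of "g 0 + 1"]]] show ?thesis
        by (simp add: algebra_simps)
    qed
    moreover have step: "nat (b 0) = Suc (nat (a 0)) mod n"
      if "[b 0 = a 0 + 1] (mod int n)" "a \<in> carrier (UP R)" "b \<in> carrier (UP R)" for a b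
    proof -
      have "b 0 = (a 0 + 1) mod int n"
        using that(1) range[OF that(3), of 0] by (simp add: cong_def)
      then have "int (nat (b 0)) = int (Suc (nat (a 0)) mod n)"
        using range[OF that(2), of 0] range[OF that(3), of 0] by (simp add: zmod_int add.commute)
      then show ?thesis
        by linarith
    qed
    ultimately consider "nat (f 0) = Suc (nat (g 0)) mod n" | "nat (g 0) = Suc (nat (f 0)) mod n"
      using e by blast
    then show "\<exists>a b. e = {a, b} \<and> a \<in> fst (involutory_cayley_graph (UP R)) \<and>
        b \<in> fst (involutory_cayley_graph (UP R)) \<and> r a = r b \<and> nat (b 0) = Suc (nat (a 0)) mod n"
    proof cases
      case 1
      with e T show ?thesis
        unfolding G by (intro exI[of _ g] exI[of _ f]) (simp add: insert_commute r_def)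
    next
      case 2
      with e T show ?thesis
        unfolding G by (intro exI[of _ f] exI[of _ g]) (simp add: r_def)
    qed
  qed
  then show ?thesis
    by (simp add: R_def)
qed

text \<open>
  Modulo 4 every polynomial $1 + 2c$ is a square root of 1, so any polynomial with all coefficients even
  is adjacent to any $1 + 2c$.  The graph contains $K_{3,3}$ on the parts $\{0, 2, 2x\}$ and
  $\{1, 3, 1 + 2x\}$.
\<close>

lemma UP_residue_ring_4_not_planar:
  "\<not> planar (involutory_cayley_graph (UP (residue_ring 4)))"
proof -
  define R where "R = residue_ring 4"
  interpret residues 4 R
    by unfold_locales (auto simp: R_def)
  have edge: "{f, g} \<in> snd (involutory_cayley_graph (UP R))"
    if fg: "f \<in> carrier (UP R)" "g \<in> carrier (UP R)"
      and odd: "odd (f 0 - g 0)" and even: "\<And>k. k > 0 \<Longrightarrow> even (f k - g k)" for f g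
  proof -
    \<comment> \<open>The coefficients of the difference are \<open>\<delta> + 2 * c\<close> with \<open>\<delta>\<close> those of 1, and the square is \<open>1 + 4 * (c + c\<^sup>2)\<close>.\<close>
    define \<delta> :: "nat \<Rightarrow> int" where "\<delta> = (\<lambda>k. if k = 0 then 1 else 0)"
    define c where "c = (\<lambda>k. (f k - g k - \<delta> k) div 2)"
    have d: "f k - g k = \<delta> k + 2 * c k" for k
      using odd even[of k] by (cases "k = 0") (auto simp: c_def \<delta>_def)
    have left: "(\<Sum>i\<le>k. \<delta> i * x i) = x 0" for k and x :: "nat \<Rightarrow> int"
      by (simp add: \<delta>_def if_distrib[of "\<lambda>t. t * _"] cong: if_cong)
    have right: "(\<Sum>i\<le>k. x i * \<delta> (k - i)) = x k" for k and x :: "nat \<Rightarrow> int"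
    proof -
      have "(\<Sum>i\<le>k. x i * \<delta> (k - i)) = (\<Sum>i\<le>k. if i = k then x i else 0)"
        by (intro sum.cong) (auto simp: \<delta>_def)
      then show ?thesis
        by simp
    qed
    have "(\<Sum>i\<le>k. (f i - g i) * (f (k - i) - g (k - i))) =
        \<delta> k + 4 * (c k + (\<Sum>i\<le>k. c i * c (k - i)))" for k
    proof -
      have "(\<Sum>i\<le>k. (f i - g i) * (f (k - i) - g (k - i))) =
          (\<Sum>i\<le>k. \<delta> i * (\<delta> (k - i) + 2 * c (k - i)) + (2 * c i * \<delta> (k - i) + 4 * (c i * c (k - i))))"
        unfolding d by (intro sum.cong) (auto simp: algebra_simps)
      also have "\<dots> = (\<delta> k + 2 * c k) + (2 * c k + 4 * (\<Sum>i\<le>k. c i * c (k - i)))"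
        by (simp add: sum.distrib left right sum_distrib_left)
      finally show ?thesis
        by simp
    qed
    then show ?thesis
      using fg by (auto simp: UP_involutory_edge_iff cong_iff_dvd_diff \<delta>_def)
  qed
  define l :: "int \<Rightarrow> int \<Rightarrow> nat \<Rightarrow> int"
    where "l = (\<lambda>a b k. if k = 0 then a else if k = 1 then b else 0)"
  have l: "l a b \<in> carrier (UP R)" if "a \<in> {0..3}" "b \<in> {0..3}" for a b
  proof -
    have "bound \<zero>\<^bsub>R\<^esub> 1 (l a b)"
      by (auto simp: l_def res_zero_eq)
    then show ?thesis
      using that by (auto simp: UP_def up_def l_def res_carrier_eq)
  qed
  have l_edge: "{l a b, l a' b'} \<in> snd (involutory_cayley_graph (UP R))"
    if "a \<in> {0..3}" "b \<in> {0..3}" "a' \<in> {0..3}" "b' \<in> {0..3}" "odd (a - a')" "even (b - b')"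
    for a b a' b'
    using that by (intro edge l) (auto simp: l_def)
  \<comment> \<open>The list closes up to a hexagon in which the two parts of $K_{3,3}$ alternate; its long diagonals are the chords.\<close>
  define v where "v = (\<lambda>i. [l 0 0, l 1 0, l 2 0, l 3 0, l 0 2, l 1 2, l 0 0] ! i)"
  have less6: "i < 6 \<longleftrightarrow> i = 0 \<or> i = 1 \<or> i = 2 \<or> i = 3 \<or> i = 4 \<or> i = (5::nat)" for i
    by auto
  have l_eq: "l a b = l a' b' \<longleftrightarrow> a = a' \<and> b = b'" for a b a' b'
  proof
    assume "l a b = l a' b'"
    then have "l a b 0 = l a' b' 0" "l a b 1 = l a' b' 1"
      by simp_all
    then show "a = a' \<and> b = b'"
      by (simp add: l_def)
  qed simp
  have "\<not> planar (involutory_cayley_graph (UP R))"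
  proof (rule cycle_with_three_crossing_chords_not_planar[of v 6 _ 3])
    show "inj_on v {..<6}"
      by (auto simp: inj_on_def less6 v_def l_eq)
    show "v ` {..<6} \<subseteq> fst (involutory_cayley_graph (UP R))"
      by (auto simp: less6 v_def involutory_cayley_graph_def intro!: l)
    show "{v i, v (Suc i)} \<in> snd (involutory_cayley_graph (UP R))" if "i < 6" for i
      using that by (auto simp: less6 v_def intro!: l_edge)
  qed (auto simp: v_def intro!: l_edge)
  then show ?thesis
    by (simp add: R_def)
qed

text \<open>
  A square root $u$ of 1 other than $\pm 1$ is also different from $\pm 2$: otherwise $n$ divides
  $4 - 1$, and $n = 3$ has the special form.  Hence $3 \<le> u \<le> n - 3$, and the chords from 0, 1, 2 to
  $u$, $u + 1$, $u + 2$ of the Hamiltonian cycle $0, 1, \<dots>, n - 1$ cross pairwise.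
\<close>

lemma residue_ring_not_planar:
  assumes n: "n \<ge> 2" "n \<noteq> 4" "\<not> odd_prime_power_or_double n"
  shows "\<not> planar (involutory_cayley_graph (residue_ring (int n)))"
proof -
  define R where "R = residue_ring (int n)"
  interpret residues "int n" R
    using n(1) by (unfold_locales) (auto simp: R_def)
  obtain w where w: "[w * w = 1] (mod int n)" "\<not> [w = 1] (mod int n)" "\<not> [w = - 1] (mod int n)"
    using nontrivial_involution[OF n] by blast
  \<comment> \<open>The listed values of \<open>c * c\<close> are those for the five residues 0, \<open>1\<close>, \<open>-1\<close>, \<open>2\<close>, \<open>-2\<close> to be excluded.\<close>
  have small: "\<not> [w = c] (mod int n)" if "c * c \<in> {0, 1, 4}" for c
  proof
    assume c: "[w = c] (mod int n)"
    have "[c * c = 1] (mod int n)"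
      using cong_trans[OF cong_sym[OF cong_mult[OF c c]] w(1)] .
    moreover have "c * c \<noteq> 1"
      using c w(2,3) by (auto simp: square_eq_1_iff)
    ultimately have "int n dvd 3"
      using that by (auto simp: cong_iff_dvd_diff)
    then have "n dvd 3"
      by presburger
    have prime3: "prime (3::nat)"
      by simp
    then have "n = 3"
      using n(1) \<open>n dvd 3\<close> unfolding prime_nat_iff by auto
    with prime3 have "odd_prime_power_or_double n"
      unfolding odd_prime_power_or_double_def
      by (intro disjI2 exI[of _ 3] exI[of _ 1]) simp
    with n(3) show False ..
  qed
  define u where "u = nat (w mod int n)"
  have u: "int u = w mod int n"
    using n(1) by (simp add: u_def)
  then have u_cong: "[int u = w] (mod int n)"
    by simp
  have "u < n"
    using n(1) by (simp add: u_def nat_less_iff)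
  have not_small: "\<not> [int u = c] (mod int n)" if "c * c \<in> {0, 1, 4}" for c
    using small[OF that] u_cong by (metis cong_sym cong_trans)
  then have not_eq: "int u \<noteq> c" if "c * c \<in> {0, 1, 4}" for c
    using that by (metis cong_refl)
  have "int u \<noteq> 0" "int u \<noteq> 1" "int u \<noteq> 2"
    by (rule not_eq; simp)+
  moreover have "int u \<noteq> int n - 1" "int u \<noteq> int n - 2"
    using not_small[of "- 1"] not_small[of "- 2"] by (auto simp: cong_iff_dvd_diff)
  ultimately have bounds: "3 \<le> u" "u + 2 < n"
    using \<open>u < n\<close> by linarith+
  have uu: "[int u * int u = 1] (mod int n)"
    using cong_trans[OF cong_mult[OF u_cong u_cong] w(1)] .
  define v where "v = (\<lambda>i. int i mod int n)"
  have edge: "{v i, v j} \<in> snd (involutory_cayley_graph R)"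
    if "[(int i - int j) * (int i - int j) = 1] (mod int n)" for i j
    unfolding v_def using that by (rule involutory_edge)
  have "\<not> planar (involutory_cayley_graph R)"
  proof (rule cycle_with_three_crossing_chords_not_planar[of v n _ u])
    show "inj_on v {..<n}"
      by (auto simp: inj_on_def v_def)
    show "v ` {..<n} \<subseteq> fst (involutory_cayley_graph R)"
      using n(1) by (auto simp: v_def involutory_cayley_graph_def res_carrier_eq)
    show "{v i, v (Suc i)} \<in> snd (involutory_cayley_graph R)" for i
      by (rule edge) simp
    show "{v 0, v u} \<in> snd (involutory_cayley_graph R)"
      "{v 1, v (u + 1)} \<in> snd (involutory_cayley_graph R)"
      "{v 2, v (u + 2)} \<in> snd (involutory_cayley_graph R)"
      using uu by (auto intro!: edge)
  qed (use bounds in \<open>auto simp: v_def\<close>)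
  then show ?thesis
    by (simp add: R_def)
qed

lemma planar_residue_ring_if_planar_UP:
  assumes "n \<ge> 2" "planar (involutory_cayley_graph (UP (residue_ring (int n))))"
  shows "planar (involutory_cayley_graph (residue_ring (int n)))"
proof -
  define R where "R = residue_ring (int n)"
  interpret residues "int n" R
    using assms(1) by unfold_locales (auto simp: R_def)
  interpret R: cring R
    by (rule cring)
  interpret UP_cring R "UP R"
    by unfold_locales simp
  have "planar (involutory_cayley_graph R)"
    using assms(2) unfolding R_def[symmetric]
    by (rule planar_of_injective_ring_hom[OF cring.axioms(1)[OF cring] UP_ring const_ring_hom monom_inj])
  then show ?thesis
    by (simp add: R_def)
qed

theorem theorem3p4:
  fixes n :: nat
  assumes "n \<ge> 2"
  shows "(planar (involutory_cayley_graph (UP (residue_ring (int n)))) \<longleftrightarrow>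
            planar (involutory_cayley_graph (residue_ring (int n))) \<and> n \<noteq> 4) \<and>
         (planar (involutory_cayley_graph (residue_ring (int n))) \<and> n \<noteq> 4 \<longleftrightarrow>
            n = 2 \<or> (\<exists>p k. prime p \<and> odd p \<and> k > 0 \<and> (n = p ^ k \<or> n = 2 * p ^ k)))"
proof -
  let ?Zx = "planar (involutory_cayley_graph (UP (residue_ring (int n))))"
  let ?Z = "planar (involutory_cayley_graph (residue_ring (int n)))"
  have "?Z \<and> n \<noteq> 4" if ?Zx
    using that UP_residue_ring_4_not_planar planar_residue_ring_if_planar_UP[OF assms]
    by (cases "n = 4") auto
  moreover have "odd_prime_power_or_double n" if "?Z \<and> n \<noteq> 4"
    using that residue_ring_not_planar[OF assms] by blast
  moreover have ?Zx if "odd_prime_power_or_double n"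
    using that UP_residue_ring_planar[OF assms] by blast
  ultimately show ?thesis
    unfolding odd_prime_power_or_double_def by blast
qed

end
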